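(* Suppose that $X$ is a complete metric space and $\Gamma\subset\Sigma$ is a compact set satisfying $\sigma(\Gamma)\subset\Gamma$. Let $\{E_{\mathtt{i}}:\mathtt{i}\in\Gamma_*\}$ be a Moran construction in $X$ for which there exists $D\ge1$ such that $\operatorname{diam}(E_{\mathtt{i}\mathtt{j}})\le D\operatorname{diam}(E_{\mathtt{i}})\operatorname{diam}(E_{\mathtt{j}})$ for all $\mathtt{i}\mathtt{j}\in\Gamma_*$, and which satisfies the uniform finite clustering property. Let $0<\overline{\alpha}<1$ be such that, for some constant $C\ge1$, $\max_{\mathtt{i}\in\Gamma_n}\operatorname{diam}(E_{\mathtt{i}})\le C\overline{\alpha}^n$ for all $n\in\mathbb{N}$. If $A\subset\Gamma$ is non-empty and compact, then $$\dim_{\mathrm A}(\pi(A'))\le\lim_{n\to\infty}\frac{\log N_n(A)}{\log\overline{\alpha}^{-n}}$$ for all microsets $A'$ of $A$.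
   Context: Shift space: $\kappa\ge2$, $\Sigma=\{1,\ldots,\kappa\}^{\mathbb{N}}$, with the metric in which two distinct words are at distance $2^{-n}$, $n$ being the first place at which they differ; $\sigma$ is the left shift. $\mathtt{i}|_n$ is the word of the first $n$ letters of $\mathtt{i}$, $\mathtt{i}|_0=\varnothing$ is the empty word. $\Sigma_*$ is the set of all finite words; for $\Gamma\subset\Sigma$, $\Gamma_n=\{\mathtt{i}|_n:\mathtt{i}\in\Gamma\}$ and $\Gamma_*=\bigcup_{n=0}^\infty\Gamma_n$. $|\mathtt{i}|$ is the length of $\mathtt{i}$, $\mathtt{i}^-$ is the non-empty finite word $\mathtt{i}$ with last letter removed, and $[\mathtt{i}]=\{\mathtt{i}\mathtt{j}:\mathtt{j}\in\Sigma\}$. Moran construction: a collection $\{E_{\mathtt{i}}:\mathtt{i}\in\Gamma_*\}$ of closed and bounded subsets of $X$ with positive diameter such that $E_{\mathtt{i}}\subset E_{\mathtt{i}^-}$ for all $\mathtt{i}\in\Gamma_*\setminus\{\varnothing\}$ and $\operatorname{diam}(E_{\mathtt{i}|_n})\to0$ as $n\to\infty$ for all $\mathtt{i}\in\Gamma$. The projection $\pi\colon\Gamma\to X$ is defined by $\{\pi(\mathtt{i})\}=\bigcap_{n=1}^\infty E_{\mathtt{i}|_n}$; the limit set is $E=\pi(\Gamma)$. (Under the sub-multiplicativity assumption on diameters in the claim, a number $\overline{\alpha}$ as required always exists.) Uniform finite clustering property: $\Gamma(r)=\{\mathtt{i}\in\Gamma_*\setminus\{\varnothing\}:\operatorname{diam}(E_{\mathtt{i}})\le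 r<\operatorname{diam}(E_{\mathtt{i}^-})\}$, $\Gamma(x,r)=\{\mathtt{i}\in\Gamma(r):E_{\mathtt{i}}\cap B(x,r)\ne\emptyset\}$ with $B(x,r)$ the closed ball; the property is $\sup_{x\in E}\sup_{r>0}\#\Gamma(x,r)<\infty$. Microsets: for $A\subset\Gamma$ and $\mathtt{i}\in\Sigma_*$ let $\beta_{\mathtt{i}}(A)=\sigma^{|\mathtt{i}|}(A\cap[\mathtt{i}])$. Sets of the form $\beta_{\mathtt{i}}(A)$ are the minisets of $A$. A set $A'\subset\Gamma$ is a microset of a compact set $A\subset\Gamma$ if there is a sequence of minisets of $A$ converging to $A'$ in the Hausdorff metric (the empty set being an isolated point, and having dimension $0$). For $n\in\mathbb{N}$, $$N_n(A)=\max\{\#\{\mathtt{i}\in\Gamma_n:A'\cap[\mathtt{i}]\ne\emptyset\}:A'\text{ is a microset of }A\}.$$ The sequence $(N_n(A))_n$ is sub-multiplicative, so the limit in the claim exists. The Assouad dimension $\dim_{\mathrm A}(A)$ is the infimum of all $t\ge 0$ for which there is a constant $C'\ge1$ such that for all $x \in A$ and $0<r<R$ the set $A\cap B(x,R)$ can be covered by at most $C'(r/R)^{-t}$ balls of radius $r$ centered at $A$. *)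

theory Defs
  imports "HOL-Analysis.Analysis" "HOL-Library.Stream"
begin

section \<open>Infinite words\<close>

text \<open>
  Infinite words are streams, with letters in \<open>{1..\<kappa>}\<close>; finite words are lists. The restriction
  of \<open>x\<close> to its first \<open>n\<close> letters is \<open>stake n x\<close>, the left shift is \<open>stl\<close>, its iterates are
  \<open>sdrop n\<close>, and \<open>w @- x\<close> is the concatenation of a finite and an infinite word.

  The places of an infinite word are counted from 1, whereas \<open>x !! n\<close> counts from 0; hence the
  \<open>Suc\<close> in the distance.
\<close>

instantiation stream :: (type) metric_space
begin

definition dist_stream :: "'a stream \<Rightarrow> 'a stream \<Rightarrow> real" where
  "dist_stream x y = (if x = y then 0 else (1/2) ^ Suc (LEAST n. x !! n \<noteq> y !! n))"

definition uniformity_stream :: "('a stream \<times> 'a stream) filter" where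
  "uniformity_stream = (INF e\<in>{0<..}. principal {(x, y). dist x y < e})"

definition open_stream :: "'a stream set \<Rightarrow> bool" where
  "open_stream U \<longleftrightarrow> (\<forall>x\<in>U. eventually (\<lambda>(x', y). x' = x \<longrightarrow> y \<in> U) uniformity)"

instance
proof
  fix x y z :: "'a stream"
  show "dist x y = 0 \<longleftrightarrow> x = y"
    by (simp add: dist_stream_def)
  show "dist x y \<le> dist x z + dist y z"
  proof (cases "x = y \<or> x = z \<or> y = z")
    case True
    have pos: "dist a b \<ge> 0" for a b :: "'a stream"
      by (simp add: dist_stream_def)
    have same: "dist a a = 0" for a :: "'a stream"
      by (simp add: dist_stream_def)
    have commute: "dist a b = dist b a" for a b :: "'a stream"
      unfolding dist_stream_def by (simp only: eq_commute[of a b] eq_commute[of "a !! _"])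
    from True show ?thesis
    proof (elim disjE)
      assume "x = y"
      then show ?thesis using pos[of y z] same[of y] by simp
    next
      assume "x = z"
      then show ?thesis using commute[of x y] same[of x] by simp
    next
      assume "y = z"
      then show ?thesis using same[of y] by simp
    qed
  next
    case False
    define d where "d a b = (LEAST n. a !! n \<noteq> b !! n)" for a b :: "'a stream"
    have agree: "a !! n = b !! n" if "n < d a b" for a b n
      using not_less_Least[of n "\<lambda>n. a !! n \<noteq> b !! n"] that by (auto simp: d_def)
    have "\<exists>n. x !! n \<noteq> y !! n"
      using False smap_alt[of "\<lambda>a. a" x y] by (simp add: stream.map_ident)
    then have differ: "x !! d x y \<noteq> y !! d x y"
      unfolding d_def by (rule LeastI_ex)
    have "d x z \<le> d x y \<or> d y z \<le> d x y"
      using agree[of "d x y" x z] agree[of "d x y" y z] differ by (metis not_le)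
    then have "(1/2::real) ^ Suc (d x y) \<le> (1/2) ^ Suc (d x z) + (1/2) ^ Suc (d y z)"
    proof
      assume "d x z \<le> d x y"
      then have "(1/2::real) ^ Suc (d x y) \<le> (1/2) ^ Suc (d x z)"
        by (intro power_decreasing) auto
      then show ?thesis
        using zero_le_power[of "1/2::real" "Suc (d y z)"] zero_le_power[of "1/2::real" "Suc (d x z)"]
        by linarith
    next
      assume "d y z \<le> d x y"
      then have "(1/2::real) ^ Suc (d x y) \<le> (1/2) ^ Suc (d y z)"
        by (intro power_decreasing) auto
      then show ?thesis
        using zero_le_power[of "1/2::real" "Suc (d y z)"] zero_le_power[of "1/2::real" "Suc (d x z)"]
        by linarith
    qed
    then show ?thesis
      using False by (simp add: dist_stream_def d_def)
  qed
qed (simp_all add: uniformity_stream_def open_stream_def)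

end

definition shift_space :: "nat \<Rightarrow> nat stream set" where
  "shift_space \<kappa> = streams {1..\<kappa>}"

definition cylinder :: "nat \<Rightarrow> nat list \<Rightarrow> nat stream set" where
  "cylinder \<kappa> w = {w @- x | x. x \<in> shift_space \<kappa>}"

definition words :: "nat stream set \<Rightarrow> nat \<Rightarrow> nat list set" where
  "words \<Gamma> n = stake n ` \<Gamma>"

definition all_words :: "nat stream set \<Rightarrow> nat list set" where
  "all_words \<Gamma> = (\<Union>n. words \<Gamma> n)"


section \<open>Moran constructions\<close>

definition moran_construction ::
    "nat stream set \<Rightarrow> (nat list \<Rightarrow> 'a::metric_space set) \<Rightarrow> bool" where
  "moran_construction \<Gamma> E \<longleftrightarrow>
     (\<forall>w\<in>all_words \<Gamma>. closed (E w) \<and> bounded (E w) \<and> diameter (E w) > 0) \<and>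
     (\<forall>w\<in>all_words \<Gamma> - {[]}. E w \<subseteq> E (butlast w)) \<and>
     (\<forall>x\<in>\<Gamma>. (\<lambda>n. diameter (E (stake n x))) \<longlonglongrightarrow> 0)"

definition proj :: "(nat list \<Rightarrow> 'a set) \<Rightarrow> nat stream \<Rightarrow> 'a" where
  "proj E x = (THE p. {p} = (\<Inter>n\<in>{1..}. E (stake n x)))"

definition limit_set :: "nat stream set \<Rightarrow> (nat list \<Rightarrow> 'a set) \<Rightarrow> 'a set" where
  "limit_set \<Gamma> E = proj E ` \<Gamma>"

definition words_of_size ::
    "nat stream set \<Rightarrow> (nat list \<Rightarrow> 'a::metric_space set) \<Rightarrow> real \<Rightarrow> nat list set" where
  "words_of_size \<Gamma> E r =
     {w \<in> all_words \<Gamma> - {[]}. diameter (E w) \<le> r \<and> r < diameter (E (butlast w))}"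

definition words_near ::
    "nat stream set \<Rightarrow> (nat list \<Rightarrow> 'a::metric_space set) \<Rightarrow> 'a \<Rightarrow> real \<Rightarrow> nat list set" where
  "words_near \<Gamma> E x r = {w \<in> words_of_size \<Gamma> E r. E w \<inter> cball x r \<noteq> {}}"

definition uniform_finite_clustering ::
    "nat stream set \<Rightarrow> (nat list \<Rightarrow> 'a::metric_space set) \<Rightarrow> bool" where
  "uniform_finite_clustering \<Gamma> E \<longleftrightarrow>
     (\<exists>M. \<forall>x\<in>limit_set \<Gamma> E. \<forall>r>0. finite (words_near \<Gamma> E x r) \<and> card (words_near \<Gamma> E x r) \<le> M)"


section \<open>Microsets\<close>

text \<open>
  The Hausdorff metric, for compact sets of infinite words. Since all distances are at most
  \<open>1/2\<close>, giving the empty set distance 1 to every other set makes it an isolated point.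
\<close>

definition hausdorff_dist :: "'a stream set \<Rightarrow> 'a stream set \<Rightarrow> real" where
  "hausdorff_dist A B =
     (if A = {} \<and> B = {} then 0
      else if A = {} \<or> B = {} then 1
      else max (SUP x\<in>A. infdist x B) (SUP y\<in>B. infdist y A))"

definition miniset :: "nat \<Rightarrow> nat list \<Rightarrow> nat stream set \<Rightarrow> nat stream set" where
  "miniset \<kappa> w A = sdrop (length w) ` (A \<inter> cylinder \<kappa> w)"

text \<open>
  A microset is a limit in the space of compact subsets of \<open>\<Gamma>\<close>, and so is itself compact; here
  this has to be said, because \<open>hausdorff_dist\<close> does not separate a set from its closure.
\<close>

definition microset ::
    "nat \<Rightarrow> nat stream set \<Rightarrow> nat stream set \<Rightarrow> nat stream set \<Rightarrow> bool" where
  "microset \<kappa> \<Gamma> A A' \<longleftrightarrow>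
     A' \<subseteq> \<Gamma> \<and> compact A' \<and>
     (\<exists>w. (\<forall>k. w k \<in> lists {1..\<kappa>}) \<and>
          (\<lambda>k::nat. hausdorff_dist (miniset \<kappa> (w k) A) A') \<longlonglongrightarrow> 0)"

definition max_words :: "nat \<Rightarrow> nat stream set \<Rightarrow> nat stream set \<Rightarrow> nat \<Rightarrow> nat" where
  "max_words \<kappa> \<Gamma> A n =
     Max {card {w \<in> words \<Gamma> n. A' \<inter> cylinder \<kappa> w \<noteq> {}} | A'. microset \<kappa> \<Gamma> A A'}"


section \<open>Assouad dimension\<close>

text \<open>Balls are closed. The value is \<open>\<infinity>\<close> if no exponent is admissible.\<close>

definition assouad_dim :: "'a::metric_space set \<Rightarrow> ereal" where
  "assouad_dim A =
     Inf (ereal ` {t. t \<ge> 0 \<and>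
       (\<exists>C\<ge>1. \<forall>x\<in>A. \<forall>r R. 0 < r \<and> r < R \<longrightarrow>
          (\<exists>F. finite F \<and> F \<subseteq> A \<and> real (card F) \<le> C * (r / R) powr (- t) \<and>
               A \<inter> cball x R \<subseteq> (\<Union>y\<in>F. cball y r)))})"

end

theory Submission
  imports Defs
begin

text \<open>
  Write \<open>N n\<close> for \<open>max_words \<kappa> \<Gamma> A n\<close>. Two words are closer than \<open>2\<^sup>-\<^sup>n\<close> exactly if their first \<open>n\<close>
  letters agree, so a set close to \<open>B\<close> in the Hausdorff metric has the same words of length \<open>n\<close>
  as \<open>B\<close>. A microset thus shares its words of any fixed length with some miniset, and
  minisets of minisets are minisets. It follows that a word of a microset of \<open>A\<close> has at most
  \<open>N n\<close> continuations by \<open>n\<close> letters inside the microset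
  (\<open>card_continuations_le_max_words\<close>), whatever the word. Applied to prefixes of length \<open>m\<close> this
  gives \<open>N (m + n) \<le> N m * N n\<close>, and Fekete's lemma gives the limit, say \<open>L\<close>. For \<open>t > L\<close> there is
  a constant \<open>K\<close> with \<open>N n \<le> K * (\<alpha> ^ n) powr (- t)\<close> for all \<open>n\<close>.

  For the dimension, let \<open>r < R\<close> and let \<open>x\<close> be the projection of a point of the microset. By the
  clustering property, every point of the limit set in the ball of radius \<open>R\<close> about \<open>x\<close> lies below
  one of boundedly many words \<open>u\<close> with \<open>diameter (E u) \<le> R\<close> (\<open>prefixes_at_scale\<close>). Continuing such
  a \<open>u\<close> by a word \<open>v\<close> of length \<open>n\<close> produces a set of diameter at most \<open>D * R * C * \<alpha> ^ n\<close>. This is at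
  most \<open>r\<close> for the least \<open>n\<close> with \<open>\<alpha> ^ n \<le> r / (D * C * R)\<close>, and then \<open>\<alpha> ^ n\<close> is comparable to
  \<open>r / R\<close>. One ball for each continuation that occurs suffices (\<open>cover_by_continuations\<close>), so the
  number of balls is at most a constant times \<open>N n\<close>, hence at most a constant times
  \<open>(r / R) powr (- t)\<close>.
\<close>

section \<open>Words, cylinders and the metric of the shift space\<close>

lemma dist_stream_less_iff: "dist x y < (1/2) ^ n \<longleftrightarrow> stake n x = stake n y"
  for x y :: "'a stream"
proof (cases "x = y")
  case False
  define d where "d = (LEAST i. x !! i \<noteq> y !! i)"
  have "\<exists>i. x !! i \<noteq> y !! i"
    using False smap_alt[of "\<lambda>a. a" x y] by (simp add: stream.map_ident)
  then have differ: "x !! d \<noteq> y !! d"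
    unfolding d_def by (rule LeastI_ex)
  have agree: "x !! i = y !! i" if "i < d" for i
    using not_less_Least[of i "\<lambda>i. x !! i \<noteq> y !! i"] that by (auto simp: d_def)
  have "dist x y < (1/2) ^ n \<longleftrightarrow> n \<le> d"
    using False by (simp only: dist_stream_def if_False d_def[symmetric]
      power_strict_decreasing_iff[of "1/2::real"]) auto
  also have "\<dots> \<longleftrightarrow> stake n x = stake n y"
    using differ agree by (auto simp: list_eq_iff_nth_eq not_less[symmetric])
  finally show ?thesis .
qed (simp add: dist_stream_def)

lemma dist_stream_le_half: "dist x y \<le> 1/2"
  for x y :: "'a stream"
  using power_decreasing[of 1 "Suc n" "1/2::real" for n] by (auto simp: dist_stream_def)

lemma infdist_stream_less_iff:
  fixes B :: "'a stream set"
  assumes "B \<noteq> {}"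
  shows "infdist x B < (1/2) ^ n \<longleftrightarrow> stake n x \<in> stake n ` B"
  using assms
  by (auto simp: infdist_notempty cINF_less_iff dist_stream_less_iff image_iff)

text \<open>
  Minisets have to be compact in order to be microsets; they are continuous images under the
  iterated shift of the intersection with a closed cylinder.
\<close>

lemma continuous_on_sdrop: "continuous_on S (sdrop m :: 'a stream \<Rightarrow> 'a stream)"
  unfolding continuous_on_iff
proof (intro ballI allI impI)
  fix x :: "'a stream" and e :: real
  assume "0 < e"
  then obtain n where n: "(1/2) ^ n < e"
    using real_arch_pow_inv[of e "1/2"] by auto
  have "dist (sdrop m y) (sdrop m x) < e" if "dist y x < (1/2) ^ (m + n)" for y
  proof -
    have "stake (m + n) y = stake (m + n) x"
      using that by (simp only: dist_stream_less_iff)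
    then have "stake n (sdrop m y) = stake n (sdrop m x)"
      by (metis drop_stake add_diff_cancel_left')
    then show ?thesis
      using n dist_stream_less_iff[of "sdrop m y" "sdrop m x" n] by linarith
  qed
  then show "\<exists>d>0. \<forall>y\<in>S. dist y x < d \<longrightarrow> dist (sdrop m y) (sdrop m x) < e"
    by (intro exI[of _ "(1/2) ^ (m + n)"]) auto
qed

lemma closed_stake_eq: "closed {x. stake n x = w}"
proof -
  have "open {x. stake n x \<noteq> w}"
    unfolding open_dist
    by (intro ballI exI[of _ "(1/2) ^ n"]) (auto simp: dist_stream_less_iff)
  then show ?thesis
    by (simp add: closed_def Collect_neg_eq[symmetric])
qed

lemma sdrop_mem_shift_space: "x \<in> shift_space \<kappa> \<Longrightarrow> sdrop n x \<in> shift_space \<kappa>"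
  unfolding shift_space_def by (induction n arbitrary: x) (auto intro: streams_stl)

lemma mem_cylinder_iff:
  assumes "x \<in> shift_space \<kappa>"
  shows "x \<in> cylinder \<kappa> w \<longleftrightarrow> stake (length w) x = w"
proof
  assume "stake (length w) x = w"
  then have "x = w @- sdrop (length w) x"
    by (metis stake_sdrop)
  moreover have "sdrop (length w) x \<in> shift_space \<kappa>"
    using assms by (rule sdrop_mem_shift_space)
  ultimately show "x \<in> cylinder \<kappa> w"
    unfolding cylinder_def by blast
qed (auto simp: cylinder_def stake_shift)

lemma stake_mem_lists: "x \<in> shift_space \<kappa> \<Longrightarrow> stake n x \<in> lists {1..\<kappa>}"
  unfolding shift_space_def
  by (induction n arbitrary: x) (auto intro: streams_stl dest: streams_shd)

lemma finite_stake_image: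
  assumes "B \<subseteq> shift_space \<kappa>"
  shows "finite (stake n ` B)"
proof (rule finite_subset)
  show "stake n ` B \<subseteq> {w. set w \<subseteq> {1..\<kappa>} \<and> length w = n}"
    using assms stake_mem_lists by (fastforce simp: in_lists_conv_set)
qed (simp add: finite_lists_length_eq)

text \<open>Turns the cylinders that are counted by \<open>max_words\<close> into an image of the set itself.\<close>

lemma words_meeting_cylinders:
  assumes "\<Gamma> \<subseteq> shift_space \<kappa>" and "B \<subseteq> \<Gamma>"
  shows "{w \<in> words \<Gamma> n. B \<inter> cylinder \<kappa> w \<noteq> {}} = stake n ` B"
proof (intro equalityI subsetI)
  fix w assume "w \<in> {w \<in> words \<Gamma> n. B \<inter> cylinder \<kappa> w \<noteq> {}}"
  then obtain x where x: "length w = n" "x \<in> B" "x \<in> cylinder \<kappa> w"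
    by (auto simp: words_def)
  then have "stake n x = w"
    using assms mem_cylinder_iff[of x \<kappa> w] by auto
  then show "w \<in> stake n ` B"
    using x by blast
next
  fix w assume "w \<in> stake n ` B"
  then obtain x where x: "x \<in> B" "w = stake n x"
    by blast
  then have "x \<in> cylinder \<kappa> w"
    using assms mem_cylinder_iff[of x \<kappa> w] by auto
  then show "w \<in> {w \<in> words \<Gamma> n. B \<inter> cylinder \<kappa> w \<noteq> {}}"
    using x assms by (auto simp: words_def)
qed


section \<open>Minisets and microsets\<close>

lemma miniset_eq:
  assumes "B \<subseteq> shift_space \<kappa>"
  shows "miniset \<kappa> w B = sdrop (length w) ` (B \<inter> {x. stake (length w) x = w})"
proof -
  have "B \<inter> cylinder \<kappa> w = B \<inter> {x. stake (length w) x = w}"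
    using assms mem_cylinder_iff[of _ \<kappa> w] by blast
  then show ?thesis
    by (simp only: miniset_def)
qed

lemma miniset_subset_shift_space: "B \<subseteq> shift_space \<kappa> \<Longrightarrow> miniset \<kappa> w B \<subseteq> shift_space \<kappa>"
  by (auto simp: miniset_def sdrop_mem_shift_space)

lemma sdrop_mem_invariant: "stl ` \<Gamma> \<subseteq> \<Gamma> \<Longrightarrow> x \<in> \<Gamma> \<Longrightarrow> sdrop n x \<in> \<Gamma>"
  by (induction n arbitrary: x) auto

lemma compact_miniset:
  assumes "B \<subseteq> shift_space \<kappa>" and "compact B"
  shows "compact (miniset \<kappa> w B)"
  unfolding miniset_eq[OF assms(1)]
  by (intro compact_continuous_image continuous_on_sdrop compact_Int_closed assms closed_stake_eq)

text \<open>
  The words of a miniset of \<open>B\<close> are read off from the longer words of \<open>B\<close>. Hence they do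
  not change when \<open>B\<close> is replaced by a sufficiently close set.
\<close>

lemma stake_miniset:
  assumes "B \<subseteq> shift_space \<kappa>"
  shows "stake n ` miniset \<kappa> w B =
    {v. length v = n \<and> w @ v \<in> stake (length w + n) ` B}"
proof (intro equalityI subsetI)
  fix v assume "v \<in> stake n ` miniset \<kappa> w B"
  then obtain x where "x \<in> B" "stake (length w) x = w" "v = stake n (sdrop (length w) x)"
    by (auto simp: miniset_eq[OF assms])
  then show "v \<in> {v. length v = n \<and> w @ v \<in> stake (length w + n) ` B}"
    by (auto simp: image_iff intro!: bexI[of _ x]) (metis stake_add)
next
  fix v assume "v \<in> {v. length v = n \<and> w @ v \<in> stake (length w + n) ` B}"
  then obtain x where x: "x \<in> B" "length v = n" "w @ v = stake (length w + n) x"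
    by auto
  then have "w @ v = stake (length w) x @ stake n (sdrop (length w) x)"
    by simp
  then have "stake (length w) x = w" "v = stake n (sdrop (length w) x)"
    unfolding append_eq_append_conv[OF disjI1, OF length_stake[symmetric]] by simp_all
  then show "v \<in> stake n ` miniset \<kappa> w B"
    using \<open>x \<in> B\<close> by (auto simp: miniset_eq[OF assms])
qed

lemma stake_miniset_miniset:
  assumes "B \<subseteq> shift_space \<kappa>"
  shows "stake n ` miniset \<kappa> v (miniset \<kappa> w B) = stake n ` miniset \<kappa> (w @ v) B"
  unfolding stake_miniset[OF miniset_subset_shift_space[OF assms]] stake_miniset[OF assms]
  by (simp add: add.assoc cong: conj_cong)

lemma hausdorff_dist_self: "hausdorff_dist B B = 0"
proof (cases "B = {}")
  case False
  have "(SUP x\<in>B. infdist x B) = (SUP x\<in>B. 0)"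
    by (rule SUP_cong) simp_all
  then show ?thesis
    using False by (simp add: hausdorff_dist_def)
qed (simp add: hausdorff_dist_def)

lemma miniset_microset:
  assumes "\<Gamma> \<subseteq> shift_space \<kappa>" and "stl ` \<Gamma> \<subseteq> \<Gamma>"
    and "A \<subseteq> \<Gamma>" and "compact A" and "w \<in> lists {1..\<kappa>}"
  shows "microset \<kappa> \<Gamma> A (miniset \<kappa> w A)"
proof -
  have "miniset \<kappa> w A \<subseteq> \<Gamma>"
    unfolding miniset_def using assms(3) sdrop_mem_invariant[OF assms(2)] by blast
  moreover have "compact (miniset \<kappa> w A)"
    using assms(1,3,4) by (intro compact_miniset) auto
  moreover have "(\<lambda>k::nat. hausdorff_dist (miniset \<kappa> w A) (miniset \<kappa> w A)) \<longlonglongrightarrow> 0"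
    by (simp only: hausdorff_dist_self tendsto_const)
  ultimately show ?thesis
    unfolding microset_def using assms(5)
    by (intro conjI exI[of _ "\<lambda>_. w"] allI) assumption+
qed

text \<open>
  For \<open>n = 0\<close> the hypothesis still says that both sets are empty or both are non-empty, because
  a non-empty set is at distance 1 from the empty set.
\<close>

lemma hausdorff_dist_less_imp_stake_eq:
  fixes B B' :: "'a stream set"
  assumes "hausdorff_dist B B' < (1/2) ^ n"
  shows "stake n ` B = stake n ` B'"
proof (cases "B = {} \<or> B' = {}")
  case True
  moreover have "(1/2::real) ^ n \<le> 1"
    by (rule power_le_one) auto
  ultimately show ?thesis
    using assms by (auto simp: hausdorff_dist_def split: if_splits)
next
  case False
  have infdist_le_half: "infdist x S \<le> 1/2" if "S \<noteq> {}" for x and S :: "'a stream set"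
    using that dist_stream_le_half infdist_le order_trans by (metis ex_in_conv)
  have sup: "infdist x T < (1/2) ^ n"
    if "(SUP x\<in>S. infdist x T) < (1/2) ^ n" "x \<in> S" "T \<noteq> {}" for x and S T :: "'a stream set"
  proof -
    have "infdist x T \<le> (SUP x\<in>S. infdist x T)"
      using that infdist_le_half by (intro cSUP_upper bdd_aboveI[of _ "1/2"]) auto
    then show ?thesis using that by linarith
  qed
  have "(SUP x\<in>B. infdist x B') < (1/2) ^ n" "(SUP x\<in>B'. infdist x B) < (1/2) ^ n"
    using assms False by (auto simp: hausdorff_dist_def)
  then have "stake n x \<in> stake n ` B'" if "x \<in> B" for x
    using that sup False infdist_stream_less_iff by blast
  moreover have "stake n x \<in> stake n ` B" if "x \<in> B'" for x
    using that sup False infdist_stream_less_iff \<open>(SUP x\<in>B'. infdist x B) < (1/2) ^ n\<close> by blast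
  ultimately show ?thesis
    by blast
qed

lemma microset_words:
  assumes "microset \<kappa> \<Gamma> A B"
  obtains w where "w \<in> lists {1..\<kappa>}" and "stake n ` B = stake n ` miniset \<kappa> w A"
proof -
  obtain w where w: "\<And>k. w k \<in> lists {1..\<kappa>}"
      "(\<lambda>k::nat. hausdorff_dist (miniset \<kappa> (w k) A) B) \<longlonglongrightarrow> 0"
    using assms by (auto simp: microset_def)
  have "\<forall>\<^sub>F k in sequentially. hausdorff_dist (miniset \<kappa> (w k) A) B < (1/2) ^ n"
    using w(2) by (rule order_tendstoD) simp
  then obtain k where "hausdorff_dist (miniset \<kappa> (w k) A) B < (1/2) ^ n"
    using eventually_sequentially by auto
  then show thesis
    using that[OF w(1)] hausdorff_dist_less_imp_stake_eq by blast
qed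

lemma max_words_eq:
  assumes "\<Gamma> \<subseteq> shift_space \<kappa>"
  shows "max_words \<kappa> \<Gamma> A n = Max ((\<lambda>B. card (stake n ` B)) ` {B. microset \<kappa> \<Gamma> A B})"
proof -
  have "{card {w \<in> words \<Gamma> n. B \<inter> cylinder \<kappa> w \<noteq> {}} |B. microset \<kappa> \<Gamma> A B} =
    (\<lambda>B. card {w \<in> words \<Gamma> n. B \<inter> cylinder \<kappa> w \<noteq> {}}) ` {B. microset \<kappa> \<Gamma> A B}"
    by blast
  also have "\<dots> = (\<lambda>B. card (stake n ` B)) ` {B. microset \<kappa> \<Gamma> A B}"
    using words_meeting_cylinders[OF assms] by (intro image_cong) (simp_all add: microset_def)
  finally show ?thesis
    unfolding max_words_def by simp
qed

lemma finite_word_counts: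
  assumes "\<Gamma> \<subseteq> shift_space \<kappa>"
  shows "finite ((\<lambda>B. card (stake n ` B)) ` {B. microset \<kappa> \<Gamma> A B})"
proof (rule finite_subset)
  show "(\<lambda>B. card (stake n ` B)) ` {B. microset \<kappa> \<Gamma> A B} \<subseteq> {..card (stake n ` \<Gamma>)}"
    using finite_stake_image[OF assms] by (auto simp: microset_def intro!: card_mono)
qed simp

lemma card_le_max_words:
  assumes "\<Gamma> \<subseteq> shift_space \<kappa>" and "microset \<kappa> \<Gamma> A B"
  shows "card (stake n ` B) \<le> max_words \<kappa> \<Gamma> A n"
  unfolding max_words_eq[OF assms(1)]
  by (rule Max_ge[OF finite_word_counts[OF assms(1)]]) (use assms(2) in blast)

lemma max_words_attained:
  assumes "\<Gamma> \<subseteq> shift_space \<kappa>" and "microset \<kappa> \<Gamma> A A"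
  obtains B where "microset \<kappa> \<Gamma> A B" and "max_words \<kappa> \<Gamma> A n = card (stake n ` B)"
proof -
  have "max_words \<kappa> \<Gamma> A n \<in> (\<lambda>B. card (stake n ` B)) ` {B. microset \<kappa> \<Gamma> A B}"
    unfolding max_words_eq[OF assms(1)]
    by (rule Max_in[OF finite_word_counts[OF assms(1)]]) (use assms(2) in blast)
  then show thesis
    using that by blast
qed

text \<open>
  A miniset of a microset of \<open>A\<close> has, up to any given length, the words of a miniset of a
  miniset of \<open>A\<close>, which is again a miniset of \<open>A\<close>. This gives a bound on the number of
  continuations of a word in a microset that does not depend on the word.
\<close>

lemma card_continuations_le_max_words:
  assumes "\<Gamma> \<subseteq> shift_space \<kappa>" and "stl ` \<Gamma> \<subseteq> \<Gamma>"
    and "A \<subseteq> \<Gamma>" and "compact A" and "microset \<kappa> \<Gamma> A B" and "u \<in> lists {1..\<kappa>}"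
  shows "card (stake n ` miniset \<kappa> u B) \<le> max_words \<kappa> \<Gamma> A n"
proof -
  obtain w where w: "w \<in> lists {1..\<kappa>}"
      "stake (length u + n) ` B = stake (length u + n) ` miniset \<kappa> w A"
    using microset_words[OF assms(5)] by blast
  have A: "A \<subseteq> shift_space \<kappa>" and B: "B \<subseteq> shift_space \<kappa>"
    using assms by (auto simp: microset_def)
  have "stake n ` miniset \<kappa> u B = stake n ` miniset \<kappa> u (miniset \<kappa> w A)"
    by (simp only: stake_miniset[OF B] stake_miniset[OF miniset_subset_shift_space[OF A]] w(2))
  also have "\<dots> = stake n ` miniset \<kappa> (w @ u) A"
    by (rule stake_miniset_miniset[OF A])
  finally have eq: "stake n ` miniset \<kappa> u B = stake n ` miniset \<kappa> (w @ u) A" .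
  have "w @ u \<in> lists {1..\<kappa>}"
    using w(1) assms(6) by simp
  then show ?thesis
    unfolding eq by (intro card_le_max_words miniset_microset assms(1-4))
qed

text \<open>
  A word of length \<open>m + n\<close> is one of length \<open>m\<close> followed by a continuation, and the bound on the
  number of continuations is the same for all words.
\<close>

lemma max_words_submultiplicative:
  assumes "\<Gamma> \<subseteq> shift_space \<kappa>" and "stl ` \<Gamma> \<subseteq> \<Gamma>"
    and "A \<subseteq> \<Gamma>" and "compact A" and "microset \<kappa> \<Gamma> A A"
  shows "max_words \<kappa> \<Gamma> A (m + n) \<le> max_words \<kappa> \<Gamma> A m * max_words \<kappa> \<Gamma> A n"
proof -
  obtain B where B: "microset \<kappa> \<Gamma> A B" "max_words \<kappa> \<Gamma> A (m + n) = card (stake (m + n) ` B)"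
    by (rule max_words_attained[OF assms(1,5), of "m + n"])
  have Bs: "B \<subseteq> shift_space \<kappa>"
    using B(1) assms(1) by (auto simp: microset_def)
  have fin: "finite (stake n ` miniset \<kappa> u B)" for u
    by (rule finite_stake_image[OF miniset_subset_shift_space[OF Bs]])
  have "stake (m + n) ` B \<subseteq> (\<Union>u\<in>stake m ` B. (@) u ` (stake n ` miniset \<kappa> u B))"
  proof
    fix v assume "v \<in> stake (m + n) ` B"
    then obtain x where x: "x \<in> B" "v = stake m x @ stake n (sdrop m x)"
      unfolding stake_add by blast
    then have "stake n (sdrop m x) \<in> stake n ` miniset \<kappa> (stake m x) B"
      unfolding stake_miniset[OF Bs] by simp
    then show "v \<in> (\<Union>u\<in>stake m ` B. (@) u ` (stake n ` miniset \<kappa> u B))"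
      using x by blast
  qed
  then have "card (stake (m + n) ` B) \<le> card (\<Union>u\<in>stake m ` B. (@) u ` (stake n ` miniset \<kappa> u B))"
    by (intro card_mono finite_UN_I finite_imageI fin finite_stake_image[OF Bs, simplified]) auto
  also have "\<dots> \<le> (\<Sum>u\<in>stake m ` B. card ((@) u ` (stake n ` miniset \<kappa> u B)))"
    by (intro card_UN_le finite_stake_image[OF Bs])
  also have "\<dots> \<le> (\<Sum>u\<in>stake m ` B. max_words \<kappa> \<Gamma> A n)"
  proof (rule sum_mono)
    fix u assume "u \<in> stake m ` B"
    then have "u \<in> lists {1..\<kappa>}"
      using Bs stake_mem_lists by blast
    then show "card ((@) u ` (stake n ` miniset \<kappa> u B)) \<le> max_words \<kappa> \<Gamma> A n"
      using card_continuations_le_max_words[OF assms(1-4) B(1)] card_image_le[OF fin] order_trans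
      by blast
  qed
  also have "\<dots> = card (stake m ` B) * max_words \<kappa> \<Gamma> A n"
    by simp
  also have "\<dots> \<le> max_words \<kappa> \<Gamma> A m * max_words \<kappa> \<Gamma> A n"
    by (intro mult_right_mono card_le_max_words assms B) simp
  finally show ?thesis
    using B(2) by simp
qed


section \<open>Subadditive sequences\<close>

text \<open>
  This is Fekete's lemma: writing \<open>n = k q + j\<close> with \<open>j < k\<close> gives \<open>f n / n \<le> f k / k + O(1 / n)\<close>
  for every fixed \<open>k\<close>, so that the quotients converge to their infimum.
\<close>

lemma subadditive_quotient_convergent:
  fixes f :: "nat \<Rightarrow> real"
  assumes nonneg: "\<And>n. f n \<ge> 0" and subadd: "\<And>m n. f (m + n) \<le> f m + f n"
  shows "convergent (\<lambda>n. f n / real n)"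
proof -
  define l where "l = (INF n\<in>{1..}. f n / real n)"
  have bdd: "bdd_below ((\<lambda>n. f n / real n) ` {1..})"
    using nonneg by (intro bdd_belowI[of _ 0]) auto
  have lower: "l \<le> f n / real n" if "n \<ge> 1" for n
    unfolding l_def using that by (intro cINF_lower bdd) auto
  have mult: "f (q * k + j) \<le> real q * f k + f j" for q k j
  proof (induction q)
    case (Suc q)
    have "f (Suc q * k + j) \<le> f k + f (q * k + j)"
      using subadd[of k "q * k + j"] by (simp add: add.assoc)
    with Suc show ?case by (simp add: algebra_simps)
  qed simp
  have "(\<lambda>n. f n / real n) \<longlonglongrightarrow> l"
  proof (rule order_tendstoI)
    fix a assume "a < l"
    then show "\<forall>\<^sub>F n in sequentially. a < f n / real n"
      using lower by (intro eventually_sequentiallyI[of 1]) (meson less_le_trans)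
  next
    fix a assume "l < a"
    then obtain k where k: "k \<ge> 1" "f k / real k < a"
      unfolding l_def using bdd by (auto simp: cINF_less_iff)
    define b where "b = (\<Sum>j<k. f j)"
    have "(\<lambda>n. f k / real k + b / real n) \<longlonglongrightarrow> f k / real k + 0"
      by (intro tendsto_intros lim_const_over_n)
    then have "\<forall>\<^sub>F n in sequentially. f k / real k + b / real n < a"
      using k(2) by (intro order_tendstoD) auto
    moreover have "\<forall>\<^sub>F n in sequentially. f n / real n \<le> f k / real k + b / real n"
    proof (rule eventually_sequentiallyI[of 1])
      fix n :: nat assume n: "n \<ge> 1"
      have "f (n mod k) \<le> b"
        unfolding b_def using k nonneg by (intro member_le_sum) auto
      moreover have "real (n div k) * f k \<le> real n / real k * f k"
        by (intro mult_right_mono nonneg of_nat_div_le_of_nat)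
      ultimately have "f n \<le> real n / real k * f k + b"
        using mult[of "n div k" k "n mod k"] by simp
      then have "f n / real n \<le> (real n / real k * f k + b) / real n"
        by (rule divide_right_mono) simp
      also have "\<dots> = f k / real k + b / real n"
        using n by (simp add: field_simps)
      finally show "f n / real n \<le> f k / real k + b / real n" .
    qed
    ultimately show "\<forall>\<^sub>F n in sequentially. f n / real n < a"
      by eventually_elim simp
  qed
  then show ?thesis
    by (rule convergentI)
qed

text \<open>
  An exponential bound on a sequence beyond some index becomes one for all indices once the
  finitely many remaining terms are absorbed by the constant; here \<open>(\<alpha> ^ n) powr (- t) \<ge> 1\<close>
  is used.
\<close>

lemma power_bound_of_quotient_limit:
  fixes N :: "nat \<Rightarrow> nat"
  assumes \<alpha>: "0 < \<alpha>" "\<alpha> < 1" and t: "0 \<le> t" and pos: "\<And>n. N n \<ge> 1"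
    and lim: "(\<lambda>n. ln (real (N n)) / ln (\<alpha> powr (- real n))) \<longlonglongrightarrow> L" and "L < t"
  obtains K where "K \<ge> 1" and "\<And>n. real (N n) \<le> K * (\<alpha> ^ n) powr (- t)"
proof -
  have "\<forall>\<^sub>F n in sequentially. ln (real (N n)) / ln (\<alpha> powr (- real n)) < t"
    using lim \<open>L < t\<close> by (rule order_tendstoD)
  then obtain m where m: "\<And>n. n \<ge> m \<Longrightarrow> ln (real (N n)) / ln (\<alpha> powr (- real n)) < t"
    by (auto simp: eventually_sequentially)
  define K where "K = 1 + (\<Sum>n<Suc m. real (N n))"
  have K1: "K \<ge> 1"
    unfolding K_def by (simp add: sum_nonneg)
  have ge1: "(\<alpha> ^ n) powr (- t) \<ge> 1" for n
    using powr_mono'[of "- t" 0 "\<alpha> ^ n"] \<alpha> t by (simp add: power_le_one)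
  have "real (N n) \<le> K * (\<alpha> ^ n) powr (- t)" for n
  proof (cases "n < Suc m")
    case True
    then have "real (N n) \<le> K"
      unfolding K_def using member_le_sum[of n "{..<Suc m}" "\<lambda>n. real (N n)"] by auto
    also have "K * 1 \<le> K * (\<alpha> ^ n) powr (- t)"
      using K1 ge1 by (intro mult_left_mono) auto
    finally show ?thesis by simp
  next
    case False
    then have n: "n \<ge> m" "n \<ge> 1" by auto
    have ln_neg: "ln \<alpha> < 0"
      using \<alpha> by (simp add: ln_less_zero)
    have eq: "ln (\<alpha> powr (- real n)) = real n * (- ln \<alpha>)"
      using \<alpha> by (simp add: ln_powr)
    have "0 < real n * (- ln \<alpha>)"
      using ln_neg n by (intro mult_pos_pos) auto
    then have "ln (real (N n)) \<le> t * (real n * (- ln \<alpha>))"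
      using m[OF n(1)] unfolding eq by (simp only: pos_divide_less_eq)
    also have "\<dots> = ln ((\<alpha> ^ n) powr (- t))"
      using \<alpha> by (simp add: ln_powr ln_realpow)
    finally have "real (N n) \<le> (\<alpha> ^ n) powr (- t)"
      using pos[of n] \<alpha> by (subst (asm) ln_le_cancel_iff) auto
    also have "1 * (\<alpha> ^ n) powr (- t) \<le> K * (\<alpha> ^ n) powr (- t)"
      using K1 by (intro mult_right_mono) auto
    finally show ?thesis by simp
  qed
  with K1 show thesis
    by (rule that)
qed

text \<open>
  The least exponent that brings a power below \<open>q\<close> misses \<open>q\<close> by no more than a factor \<open>\<alpha>\<close>.
\<close>

lemma power_at_scale:
  fixes \<alpha> q :: real
  assumes "0 < \<alpha>" "\<alpha> < 1" "0 < q" "q < 1"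
  obtains n where "n \<ge> 1" and "\<alpha> ^ n \<le> q" and "\<alpha> * q \<le> \<alpha> ^ n"
proof -
  define n where "n = (LEAST n. \<alpha> ^ n \<le> q)"
  have "\<exists>n. \<alpha> ^ n \<le> q"
    using real_arch_pow_inv[of q \<alpha>] assms less_imp_le by blast
  then have le: "\<alpha> ^ n \<le> q"
    unfolding n_def by (rule LeastI_ex)
  then obtain k where k: "n = Suc k"
    using assms by (cases n) auto
  then have "q < \<alpha> ^ k"
    using not_less_Least[of k "\<lambda>n. \<alpha> ^ n \<le> q"] n_def by auto
  then show thesis
    using that[of n] le k assms by auto
qed


section \<open>Moran constructions\<close>

lemma stake_mem_all_words: "x \<in> \<Gamma> \<Longrightarrow> stake n x \<in> all_words \<Gamma>"
  by (auto simp: all_words_def words_def)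

lemma moran_antimono:
  assumes "moran_construction \<Gamma> E" and "x \<in> \<Gamma>" and "m \<le> n"
  shows "E (stake n x) \<subseteq> E (stake m x)"
  using assms(3)
proof (induction n rule: dec_induct)
  case (step n)
  have "E (stake (Suc n) x) \<subseteq> E (butlast (stake (Suc n) x))"
    using assms(1) stake_mem_all_words[OF assms(2), of "Suc n"]
    unfolding moran_construction_def by (metis DiffI singletonD stake_invert_Nil nat.distinct(1))
  then show ?case
    using step by (simp add: stake_Suc del: stake.simps)
qed simp

text \<open>
  By completeness, the nested sets along \<open>x\<close> have exactly one common point, and the definite
  description in \<open>proj\<close> denotes it. The case \<open>n = 0\<close>, which the intersection leaves out, follows
  because the sets are decreasing.
\<close>

lemma proj_mem:
  fixes E :: "nat list \<Rightarrow> 'a::complete_space set"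
  assumes "moran_construction \<Gamma> E" and "x \<in> \<Gamma>"
  shows "proj E x \<in> E (stake n x)"
proof -
  let ?S = "\<lambda>n. E (stake (Suc n) x)"
  have word: "closed (E (stake n x))" "bounded (E (stake n x))" "diameter (E (stake n x)) > 0" for n
    using assms stake_mem_all_words[OF assms(2)] by (auto simp: moran_construction_def)
  have "\<exists>a. \<Inter>(range ?S) = {a}"
  proof (rule decreasing_closed_nest_sing)
    show "?S n \<noteq> {}" for n
      using word(3)[of "Suc n"] by auto
    show "?S n \<subseteq> ?S m" if "m \<le> n" for m n
      using that by (intro moran_antimono[OF assms]) simp
  next
    fix e :: real assume "e > 0"
    have "(\<lambda>n. diameter (E (stake n x))) \<longlonglongrightarrow> 0"
      using assms by (simp add: moran_construction_def)
    then have "(\<lambda>n. diameter (?S n)) \<longlonglongrightarrow> 0"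
      by (rule LIMSEQ_Suc)
    then have "\<forall>\<^sub>F n in sequentially. diameter (?S n) < e"
      using \<open>e > 0\<close> by (rule order_tendstoD)
    then obtain n where "diameter (?S n) < e"
      by (auto simp: eventually_sequentially)
    then show "\<exists>n. \<forall>y\<in>?S n. \<forall>z\<in>?S n. dist y z < e"
      using diameter_bounded_bound[OF word(2)] le_less_trans by blast
  qed (rule word)
  moreover have "(\<Inter>n\<in>{1..}. E (stake n x)) = \<Inter>(range ?S)"
    by (simp only: One_nat_def atLeast_Suc_greaterThan greaterThan_0 image_image)
  ultimately obtain a where a: "(\<Inter>n\<in>{1..}. E (stake n x)) = {a}"
    by auto
  then have "proj E x = a"
    unfolding proj_def by (intro the_equality) auto
  then have "proj E x \<in> (\<Inter>n\<in>{1..}. E (stake n x))"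
    by (simp only: a singleton_iff)
  then have "proj E x \<in> E (stake (Suc n) x)"
    by (rule INT_D) simp
  then show ?thesis
    using moran_antimono[OF assms, of n "Suc n"] by auto
qed

text \<open>
  At a scale below \<open>diameter (E [])\<close> the relevant prefixes are the words of that size, whose
  number near a point of the limit set is bounded by the clustering property. A word of size
  \<open>R\<close> has a parent larger than \<open>R\<close>, so there is none at the larger scales, where the empty
  word is a prefix that serves all points.
\<close>

lemma prefixes_at_scale:
  fixes E :: "nat list \<Rightarrow> 'a::complete_space set"
  assumes moran: "moran_construction \<Gamma> E" and "uniform_finite_clustering \<Gamma> E"
  obtains M where "M \<ge> 1"
    and "\<And>x R. x \<in> limit_set \<Gamma> E \<Longrightarrow> 0 < R \<Longrightarrow>
      \<exists>U\<subseteq>all_words \<Gamma>. finite U \<and> card U \<le> M \<and> (\<forall>u\<in>U. diameter (E u) \<le> R) \<and>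
        (\<forall>y\<in>\<Gamma>. proj E y \<in> cball x R \<longrightarrow> (\<exists>k. stake k y \<in> U))"
proof -
  obtain M where M: "\<And>x R. x \<in> limit_set \<Gamma> E \<Longrightarrow> 0 < R \<Longrightarrow>
      finite (words_near \<Gamma> E x R) \<and> card (words_near \<Gamma> E x R) \<le> M"
    using assms(2) by (auto simp: uniform_finite_clustering_def)
  have "\<exists>U\<subseteq>all_words \<Gamma>. finite U \<and> card U \<le> max M 1 \<and> (\<forall>u\<in>U. diameter (E u) \<le> R) \<and>
        (\<forall>y\<in>\<Gamma>. proj E y \<in> cball x R \<longrightarrow> (\<exists>k. stake k y \<in> U))"
    if x: "x \<in> limit_set \<Gamma> E" and R: "0 < R" for x R
  proof (cases "R < diameter (E [])")
    case False
    have "\<Gamma> \<noteq> {}"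
      using x by (auto simp: limit_set_def)
    then have "[] \<in> all_words \<Gamma>"
      using stake_mem_all_words[of _ \<Gamma> 0] by fastforce
    then show ?thesis
      using False by (intro exI[of _ "{[]}"]) (auto intro: exI[of _ 0])
  next
    case True
    have "\<exists>k. stake k y \<in> words_near \<Gamma> E x R" if y: "y \<in> \<Gamma>" "proj E y \<in> cball x R" for y
    proof -
      have "(\<lambda>n. diameter (E (stake n y))) \<longlonglongrightarrow> 0"
        using moran y by (simp add: moran_construction_def)
      then have "\<forall>\<^sub>F n in sequentially. diameter (E (stake n y)) < R"
        using R by (rule order_tendstoD)
      then have ex: "\<exists>n. diameter (E (stake n y)) \<le> R"
        by (auto simp: eventually_sequentially intro: less_imp_le)
      define k where "k = (LEAST n. diameter (E (stake n y)) \<le> R)"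
      have k: "diameter (E (stake k y)) \<le> R"
        unfolding k_def using ex by (rule LeastI_ex)
      then obtain j where j: "k = Suc j"
        using True by (cases k) auto
      then have "R < diameter (E (stake j y))"
        using not_less_Least[of j "\<lambda>n. diameter (E (stake n y)) \<le> R"] k_def by auto
      then have "R < diameter (E (butlast (stake k y)))"
        by (simp add: j stake_Suc del: stake.simps)
      then have "stake k y \<in> words_of_size \<Gamma> E R"
        using k j stake_mem_all_words[OF y(1), of k] by (simp add: words_of_size_def)
      moreover have "proj E y \<in> E (stake k y) \<inter> cball x R"
        using proj_mem[OF moran y(1)] y(2) by blast
      ultimately show ?thesis
        unfolding words_near_def by blast
    qed
    moreover have "words_near \<Gamma> E x R \<subseteq> all_words \<Gamma>"
      "\<forall>u\<in>words_near \<Gamma> E x R. diameter (E u) \<le> R"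
      by (auto simp: words_near_def words_of_size_def)
    ultimately show ?thesis
      using M[OF x R] by (intro exI[of _ "words_near \<Gamma> E x R"]) auto
  qed
  then show thesis
    by (intro that[of "max M 1"]) auto
qed

text \<open>
  The continuation of a word \<open>u\<close> by \<open>n\<close> letters has diameter at most
  \<open>D * diameter (E u) * d\<close>, by sub-multiplicativity. Every continuation that occurs in \<open>B\<close>
  therefore contributes one ball, centred at the projection of any point of \<open>B\<close> below it.
\<close>

lemma cover_by_continuations:
  fixes E :: "nat list \<Rightarrow> 'a::complete_space set"
  assumes moran: "moran_construction \<Gamma> E"
    and \<Gamma>: "\<Gamma> \<subseteq> shift_space \<kappa>" "stl ` \<Gamma> \<subseteq> \<Gamma>" and B: "B \<subseteq> \<Gamma>"
    and U: "finite U" "U \<subseteq> all_words \<Gamma>" "\<And>u. u \<in> U \<Longrightarrow> diameter (E u) \<le> R"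
    and prefix: "\<And>y. y \<in> B \<Longrightarrow> proj E y \<in> S \<Longrightarrow> \<exists>k. stake k y \<in> U"
    and D: "D \<ge> 0"
    and submult: "\<And>v w. v @ w \<in> all_words \<Gamma> \<Longrightarrow>
      diameter (E (v @ w)) \<le> D * diameter (E v) * diameter (E w)"
    and d: "\<And>v. v \<in> words \<Gamma> n \<Longrightarrow> diameter (E v) \<le> d" "D * R * d \<le> r"
    and R: "0 \<le> R"
    and N: "\<And>u. u \<in> lists {1..\<kappa>} \<Longrightarrow> card (stake n ` miniset \<kappa> u B) \<le> N"
  obtains F where "finite F" "F \<subseteq> proj E ` B" "card F \<le> card U * N"
    "proj E ` B \<inter> S \<subseteq> (\<Union>y\<in>F. cball y r)"
proof -
  have Bs: "B \<subseteq> shift_space \<kappa>"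
    using \<Gamma> B by auto
  have fin: "finite (stake n ` miniset \<kappa> u B)" for u
    by (rule finite_stake_image[OF miniset_subset_shift_space[OF Bs]])
  define W where "W = (\<Union>u\<in>U. (@) u ` (stake n ` miniset \<kappa> u B))"
  have W_iff: "w \<in> W \<longleftrightarrow>
      (\<exists>u\<in>U. \<exists>v. w = u @ v \<and> length v = n \<and> u @ v \<in> stake (length u + n) ` B)" for w
    by (auto simp: W_def stake_miniset[OF Bs])
  have finW: "finite W"
    unfolding W_def by (intro finite_UN_I finite_imageI U(1) fin[simplified])
  have "card W \<le> (\<Sum>u\<in>U. card ((@) u ` (stake n ` miniset \<kappa> u B)))"
    unfolding W_def by (intro card_UN_le U)
  also have "\<dots> \<le> (\<Sum>u\<in>U. N)"
  proof (rule sum_mono)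
    fix u assume "u \<in> U"
    then have "u \<in> lists {1..\<kappa>}"
      using U(2) \<Gamma>(1) stake_mem_lists unfolding all_words_def words_def by blast
    then show "card ((@) u ` (stake n ` miniset \<kappa> u B)) \<le> N"
      using N card_image_le[OF fin] order_trans by blast
  qed
  finally have cardW: "card W \<le> card U * N"
    by simp
  have "\<exists>y. y \<in> B \<and> stake (length w) y = w" if "w \<in> W" for w
    using that unfolding W_iff by (metis imageE length_stake)
  then obtain c where c: "\<And>w. w \<in> W \<Longrightarrow> c w \<in> B \<and> stake (length w) (c w) = w"
    by metis
  have "\<exists>w\<in>W. dist (proj E (c w)) (proj E y) \<le> r" if y: "y \<in> B" "proj E y \<in> S" for y
  proof -
    obtain k where k: "stake k y \<in> U"
      using prefix[OF y] by blast
    define u v where "u = stake k y" and "v = stake n (sdrop k y)"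
    have uv: "u @ v = stake (k + n) y"
      by (simp add: u_def v_def)
    have y\<Gamma>: "y \<in> \<Gamma>"
      using y B by auto
    have word: "u @ v \<in> all_words \<Gamma>"
      unfolding uv by (rule stake_mem_all_words[OF y\<Gamma>])
    have W: "u @ v \<in> W"
      unfolding W_iff using k y(1) uv by (intro bexI[of _ u] exI[of _ v]) (auto simp: u_def v_def)
    have "v \<in> words \<Gamma> n"
      unfolding v_def words_def using sdrop_mem_invariant[OF \<Gamma>(2) y\<Gamma>] by blast
    have "0 < diameter (E v)"
      using moran \<open>v \<in> words \<Gamma> n\<close> by (auto simp: moran_construction_def all_words_def)
    have "diameter (E (u @ v)) \<le> D * diameter (E u) * diameter (E v)"
      by (rule submult[OF word])
    also have "\<dots> \<le> D * R * d"
      using D R U(3) k d(1)[OF \<open>v \<in> words \<Gamma> n\<close>] \<open>0 < diameter (E v)\<close>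
      by (intro mult_mono mult_left_mono) (auto simp: u_def)
    finally have "diameter (E (u @ v)) \<le> r"
      using d(2) by linarith
    moreover have "proj E y \<in> E (u @ v)"
      unfolding uv by (rule proj_mem[OF moran y\<Gamma>])
    moreover have "proj E (c (u @ v)) \<in> E (u @ v)"
      using proj_mem[OF moran, of "c (u @ v)" "length (u @ v)"] c[OF W] B by auto
    moreover have "bounded (E (u @ v))"
      using moran word by (simp add: moran_construction_def)
    ultimately show ?thesis
      using W diameter_bounded_bound order_trans by blast
  qed
  then have "proj E ` B \<inter> S \<subseteq> (\<Union>y\<in>(proj E \<circ> c) ` W. cball y r)"
    by fastforce
  moreover have "(proj E \<circ> c) ` W \<subseteq> proj E ` B"
    using c by auto
  moreover have "card ((proj E \<circ> c) ` W) \<le> card U * N"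
    using card_image_le[OF finW] cardW order_trans by blast
  ultimately show thesis
    using finW by (intro that[of "(proj E \<circ> c) ` W"]) auto
qed

lemma assouad_dim_leI:
  assumes "t \<ge> 0" and "C \<ge> 1"
    and "\<And>x r R. x \<in> A \<Longrightarrow> 0 < r \<Longrightarrow> r < R \<Longrightarrow>
      \<exists>F. finite F \<and> F \<subseteq> A \<and> real (card F) \<le> C * (r / R) powr (- t) \<and>
        A \<inter> cball x R \<subseteq> (\<Union>y\<in>F. cball y r)"
  shows "assouad_dim A \<le> ereal t"
  unfolding assouad_dim_def using assms by (intro Inf_lower imageI) auto


section \<open>The dimension of projected microsets\<close>

theorem proposition3p13:
  fixes \<kappa> :: nat
    and \<Gamma> A :: "nat stream set"
    and E :: "nat list \<Rightarrow> 'a::complete_space set"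
    and D C \<alpha> :: real
  assumes "\<kappa> \<ge> 2"
    and "\<Gamma> \<subseteq> shift_space \<kappa>" and "compact \<Gamma>" and "stl ` \<Gamma> \<subseteq> \<Gamma>"
    and "moran_construction \<Gamma> E"
    and "D \<ge> 1"
    and "\<And>v w. v @ w \<in> all_words \<Gamma> \<Longrightarrow>
           diameter (E (v @ w)) \<le> D * diameter (E v) * diameter (E w)"
    and "uniform_finite_clustering \<Gamma> E"
    and "0 < \<alpha>" and "\<alpha> < 1" and "C \<ge> 1"
    and "\<And>n. n \<ge> 1 \<Longrightarrow> Max ((\<lambda>w. diameter (E w)) ` words \<Gamma> n) \<le> C * \<alpha> ^ n"
    and "A \<subseteq> \<Gamma>" and "A \<noteq> {}" and "compact A"
  shows "convergent (\<lambda>n. ln (real (max_words \<kappa> \<Gamma> A n)) / ln (\<alpha> powr (- real n))) \<and>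
    (\<forall>A'. microset \<kappa> \<Gamma> A A' \<longrightarrow>
       assouad_dim (proj E ` A') \<le>
         ereal (lim (\<lambda>n. ln (real (max_words \<kappa> \<Gamma> A n)) / ln (\<alpha> powr (- real n)))))"
proof -
  let ?N = "max_words \<kappa> \<Gamma> A"
  let ?q = "\<lambda>n. ln (real (?N n)) / ln (\<alpha> powr (- real n))"
  note \<Gamma> = assms(2,4) and moran = assms(5) and A = assms(13,15)
  have "miniset \<kappa> [] A = A"
    using assms(2,13) by (subst miniset_eq) auto
  then have self: "microset \<kappa> \<Gamma> A A"
    using miniset_microset[OF \<Gamma> A, of "[]"] by simp
  have N_pos: "?N n \<ge> 1" for n
  proof -
    have "card (stake n ` A) \<noteq> 0"
      using assms(14) finite_stake_image[of A \<kappa> n] \<Gamma>(1) A(1) by auto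
    then show ?thesis
      using card_le_max_words[OF \<Gamma>(1) self, of n] by linarith
  qed
  have "convergent (\<lambda>n. ln (real (?N n)) / real n)"
  proof (rule subadditive_quotient_convergent)
    show "0 \<le> ln (real (?N n))" for n
      using N_pos[of n] by simp
    show "ln (real (?N (m + n))) \<le> ln (real (?N m)) + ln (real (?N n))" for m n
    proof -
      have "real (?N (m + n)) \<le> real (?N m) * real (?N n)"
        using max_words_submultiplicative[OF \<Gamma> A self] by (metis of_nat_le_iff of_nat_mult)
      then have "ln (real (?N (m + n))) \<le> ln (real (?N m) * real (?N n))"
        using N_pos[of "m + n"] by (intro ln_mono) auto
      then show ?thesis
        using N_pos[of m] N_pos[of n] by (simp add: ln_mult)
    qed
  qed
  then obtain h where h: "(\<lambda>n. ln (real (?N n)) / real n) \<longlonglongrightarrow> h"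
    by (auto simp: convergent_def)
  have "(\<lambda>n. ln (real (?N n)) / real n / (- ln \<alpha>)) \<longlonglongrightarrow> h / (- ln \<alpha>)"
    using h by (rule tendsto_divide) (use assms(9,10) in auto)
  also have "(\<lambda>n. ln (real (?N n)) / real n / (- ln \<alpha>)) = ?q"
    using assms(9) by (simp add: ln_powr)
  finally have lim: "?q \<longlonglongrightarrow> h / (- ln \<alpha>)" .
  define L where "L = h / (- ln \<alpha>)"
  have q_nonneg: "0 \<le> ?q n" for n
  proof -
    have "0 \<le> ln (real (?N n))"
      using N_pos[of n] by simp
    moreover have "0 \<le> ln (\<alpha> powr (- real n))"
      using assms(9,10) by (simp add: ln_powr mult_le_0_iff)
    ultimately show ?thesis by (rule divide_nonneg_nonneg)
  qed
  have "0 \<le> L"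
    unfolding L_def using lim by (rule LIMSEQ_le_const) (use q_nonneg in auto)
  have "assouad_dim (proj E ` B) \<le> ereal L" if B: "microset \<kappa> \<Gamma> A B" for B
  proof (rule ereal_le_epsilon2)
    fix e :: real assume "0 < e"
    define t where "t = L + e"
    have t: "0 \<le> t" "L < t"
      using \<open>0 < e\<close> \<open>0 \<le> L\<close> by (auto simp: t_def)
    obtain K where K: "K \<ge> 1" "\<And>n. real (?N n) \<le> K * (\<alpha> ^ n) powr (- t)"
      using power_bound_of_quotient_limit[OF assms(9,10) t(1) N_pos lim[folded L_def] t(2)] by blast
    obtain M where M: "M \<ge> 1" "\<And>x R. x \<in> limit_set \<Gamma> E \<Longrightarrow> 0 < R \<Longrightarrow>
      \<exists>U\<subseteq>all_words \<Gamma>. finite U \<and> card U \<le> M \<and> (\<forall>u\<in>U. diameter (E u) \<le> R) \<and>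
        (\<forall>y\<in>\<Gamma>. proj E y \<in> cball x R \<longrightarrow> (\<exists>k. stake k y \<in> U))"
      using prefixes_at_scale[OF moran assms(8)] by blast
    have B\<Gamma>: "B \<subseteq> \<Gamma>"
      using B by (simp add: microset_def)
    have DC: "1 \<le> D * C"
      using mult_mono[of 1 D 1 C] assms(6,11) by simp
    define c where "c = (\<alpha> / (D * C)) powr (- t)"
    have c: "1 \<le> c"
      using powr_mono'[of "- t" 0 "\<alpha> / (D * C)"] assms(9,10) DC t(1)
      by (auto simp: c_def split: if_splits)
    have "assouad_dim (proj E ` B) \<le> ereal t"
    proof (rule assouad_dim_leI[OF t(1)])
      have "1 * 1 * 1 \<le> real M * K * c"
        using M(1) K(1) c by (intro mult_mono) auto
      then show "1 \<le> real M * K * c"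
        by simp
    next
      fix x r R assume x: "x \<in> proj E ` B" and r: "0 < r" "r < (R::real)"
      have R: "0 < R"
        using r by simp
      have "x \<in> limit_set \<Gamma> E"
        using x B\<Gamma> by (auto simp: limit_set_def)
      then obtain U where U: "U \<subseteq> all_words \<Gamma>" "finite U" "card U \<le> M"
          "\<And>u. u \<in> U \<Longrightarrow> diameter (E u) \<le> R"
          "\<And>y. y \<in> \<Gamma> \<Longrightarrow> proj E y \<in> cball x R \<Longrightarrow> \<exists>k. stake k y \<in> U"
        using M(2)[OF _ R] by metis
      \<comment> \<open>Continuing the words in \<open>U\<close> by \<open>n\<close> letters reaches the size \<open>r\<close> once \<open>\<alpha> ^ n \<le> q\<close>.\<close>
      define q where "q = 1 / (D * C) * (r / R)"
      have "1 / (D * C) \<le> 1" "0 < 1 / (D * C)" "r / R < 1" "0 < r / R"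
        using DC r R by auto
      then have q: "0 < q" "q < 1"
        unfolding q_def using mult_left_le_one_le[of "r / R" "1 / (D * C)"]
        by (intro mult_pos_pos, linarith+)
      obtain n where n: "n \<ge> 1" "\<alpha> ^ n \<le> q" "\<alpha> * q \<le> \<alpha> ^ n"
        using power_at_scale[OF assms(9,10) q] by blast
      have "D * R * (C * \<alpha> ^ n) \<le> D * R * (C * q)"
        using n(2) assms(6,11) R by (intro mult_left_mono) auto
      also have "\<dots> = r"
        using DC R by (auto simp: q_def)
      finally have scale: "D * R * (C * \<alpha> ^ n) \<le> r" .
      have diam: "diameter (E v) \<le> C * \<alpha> ^ n" if "v \<in> words \<Gamma> n" for v
      proof -
        have "finite ((\<lambda>w. diameter (E w)) ` words \<Gamma> n)"
          unfolding words_def by (intro finite_imageI finite_stake_image[OF \<Gamma>(1)])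
        then have "diameter (E v) \<le> Max ((\<lambda>w. diameter (E w)) ` words \<Gamma> n)"
          using that by (intro Max_ge) auto
        then show ?thesis
          using assms(12)[OF n(1)] by linarith
      qed
      have prefix: "\<exists>k. stake k y \<in> U" if "y \<in> B" "proj E y \<in> cball x R" for y
        using U(5) that B\<Gamma> by blast
      have count: "card (stake n ` miniset \<kappa> u B) \<le> ?N n" if "u \<in> lists {1..\<kappa>}" for u
        by (rule card_continuations_le_max_words[OF \<Gamma> A B that])
      have nonneg: "0 \<le> D" "0 \<le> R"
        using assms(6) R by auto
      obtain F where F: "finite F" "F \<subseteq> proj E ` B" "card F \<le> card U * ?N n"
          "proj E ` B \<inter> cball x R \<subseteq> (\<Union>y\<in>F. cball y r)"
        using cover_by_continuations[OF moran \<Gamma> B\<Gamma> U(2,1,4) prefix nonneg(1) assms(7) diam scale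
          nonneg(2) count] by blast
      have "card F \<le> M * ?N n"
        using F(3) U(3) mult_le_mono1 order_trans by blast
      then have "real (card F) \<le> real M * real (?N n)"
        by (metis of_nat_le_iff of_nat_mult)
      also have "\<dots> \<le> real M * (K * (\<alpha> ^ n) powr (- t))"
        using K(2) by (intro mult_left_mono) auto
      also have "\<dots> \<le> real M * (K * (\<alpha> * q) powr (- t))"
        using n(3) t(1) q assms(9) K(1) by (intro mult_left_mono powr_mono2') auto
      also have "\<alpha> * q = \<alpha> / (D * C) * (r / R)"
        by (simp add: q_def)
      also have "(\<alpha> / (D * C) * (r / R)) powr (- t) = c * (r / R) powr (- t)"
        unfolding c_def by (rule powr_mult)
      finally have "real (card F) \<le> real M * K * c * (r / R) powr (- t)"
        by (simp add: mult.assoc)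
      then show "\<exists>F. finite F \<and> F \<subseteq> proj E ` B \<and> real (card F) \<le> real M * K * c * (r / R) powr (- t) \<and>
          proj E ` B \<inter> cball x R \<subseteq> (\<Union>y\<in>F. cball y r)"
        using F by blast
    qed
    then show "assouad_dim (proj E ` B) \<le> ereal L + ereal e"
      by (simp add: t_def)
  qed
  moreover have "lim ?q = L"
    unfolding L_def using lim by (rule limI)
  ultimately show ?thesis
    using lim by (auto simp: convergent_def)
qed

end
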